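(* Let $\mathrm T$ be any chain in $\langle\mathcal C,\le\rangle$ and let $\mathrm T'$ be any chain in $\langle\mathcal C,\le\rangle$ such that for each $C\in\mathrm T'$ there is $C'\in\mathrm T'$ with $C<C'$. Then there exists $C_0\in{}^*\mathbf T$ such that ${}^*\mathbf C\le C_0$ for every $C\in\mathrm T$, and there exists $C_0'\in{}^*\mathbf T'$ which is a purely subtle consequence operator such that ${}^*\mathbf C<C_0'$ for every $C\in\mathrm T'$. Moreover, every member of ${}^*\mathbf T$ and of ${}^*\mathbf T'$ is a subtle consequence operator.
   Context: A consequence operator on a nonempty set $L$ is a map $C\colon\mathcal P(L)\to\mathcal P(L)$ satisfying (i) $X\subseteq C(X)=C(C(X))\subseteq L$ and (ii) $X\subseteq Y\Rightarrow C(X)\subseteq C(Y)$; it is finite if (iii) $C(X)=\bigcup\{C(A):A\text{ finite},A\subseteq X\}$. $C_1\le C_2$ iff $C_1(X)\subseteq C_2(X)$ for all $X$; $<$ means $\le$ and $\ne$. Setting: $L$ is an infinite set of words (nonempty finite strings over a finite alphabet); via a fixed injection of the words into $\mathbb N$ and an identification map, $L$ and everything built from it (subsets, operators, sets of operators) are transported into the superstructure $\mathcal N$ over the atoms $\mathbb N$; transported objects are written in bold ($\mathbf L,\mathbf B,\mathbf C,\mathbf T$). $\mathcal C$ denotes the set of all consequence operators on $L$ except the inconsistent one $U\colon X\mapsto L$. ${}^*\mathcal N$ is a nonstandard elementary extension of $\mathcal N$ which is an enlargement; ${}^*A$ is the nonstandard extension of $A$; standard elements are identified with their $*$-images (so $\mathbf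 L\subseteq{}^*\mathbf L$). For a consequence operator $C$, ${}^*\mathbf C$ acts on internal subsets of ${}^*\mathbf L$; the order $\le$ on ${}^*\mathbf T$ is the $*$-transferred order (pointwise inclusion on internal subsets). For a set $A$, ${}^\sigma A=\{{}^*a: a\in A\}$. A subtle consequence operator is a map $C\in{}^*\mathcal N$ from a family of sets into a family of sets satisfying axioms (i),(ii) or (i),(iii), or the $*$-transfers of (i),(ii) or of (i),(iii). A subtle consequence operator $C$ is purely subtle if there is no similarly defined $D\in\mathcal N$ with $C={}^\sigma\mathbf D$ or $C={}^*\mathbf D$. *)

theory Defs
  imports "HOL-Library.FuncSet" "HOL-Library.Extended_Nat"
begin

section \<open>Consequence operators\<close>

text \<open>
  A map on the subsets of \<open>L\<close> is an extensional function, so that HOL equality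
  is equality of maps on \<open>Pow L\<close>.
\<close>

definition cons_op :: "'a set \<Rightarrow> ('a set \<Rightarrow> 'a set) \<Rightarrow> bool" where
  "cons_op L C \<longleftrightarrow>
     C \<in> Pow L \<rightarrow>\<^sub>E Pow L \<and>
     (\<forall>X\<in>Pow L. X \<subseteq> C X \<and> C X = C (C X) \<and> C X \<subseteq> L) \<and>
     (\<forall>X\<in>Pow L. \<forall>Y\<in>Pow L. X \<subseteq> Y \<longrightarrow> C X \<subseteq> C Y)"

definition cons_ops :: "'a set \<Rightarrow> ('a set \<Rightarrow> 'a set) set" where
  "cons_ops L = {C. cons_op L C} - {\<lambda>X\<in>Pow L. L}"

definition op_le :: "'a set \<Rightarrow> ('a set \<Rightarrow> 'a set) \<Rightarrow> ('a set \<Rightarrow> 'a set) \<Rightarrow> bool" where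
  "op_le L C1 C2 \<longleftrightarrow> (\<forall>X\<in>Pow L. C1 X \<subseteq> C2 X)"

definition op_less :: "'a set \<Rightarrow> ('a set \<Rightarrow> 'a set) \<Rightarrow> ('a set \<Rightarrow> 'a set) \<Rightarrow> bool" where
  "op_less L C1 C2 \<longleftrightarrow> op_le L C1 C2 \<and> C1 \<noteq> C2"

section \<open>Set-theoretic structures with atoms\<close>

text \<open>
  Both the superstructure and its nonstandard extension are presented as a type with
  a membership relation and a distinguished element, the set of atoms (the naturals,
  respectively the hypernaturals). Objects that are not atoms are sets. An element
  of the nonstandard structure is an internal object; external sets of
  internal objects are HOL sets.
\<close>

record 'a model =
  mem :: "'a \<Rightarrow> 'a \<Rightarrow> bool"
  nats :: 'a

definition elts :: "'a model \<Rightarrow> 'a \<Rightarrow> 'a set" where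
  "elts M a = {x. mem M x a}"

definition is_set :: "'a model \<Rightarrow> 'a \<Rightarrow> bool" where
  "is_set M a \<longleftrightarrow> \<not> mem M a (nats M)"

definition incl :: "'a model \<Rightarrow> 'a \<Rightarrow> 'a \<Rightarrow> bool" where
  "incl M a b \<longleftrightarrow> elts M a \<subseteq> elts M b"

text \<open>\<open>p\<close> is the Kuratowski pair of \<open>x\<close> and \<open>y\<close>.\<close>

definition is_pair :: "'a model \<Rightarrow> 'a \<Rightarrow> 'a \<Rightarrow> 'a \<Rightarrow> bool" where
  "is_pair M p x y \<longleftrightarrow>
     (\<exists>u v. is_set M u \<and> elts M u = {x} \<and> is_set M v \<and> elts M v = {x, y} \<and>
            is_set M p \<and> elts M p = {u, v})"

definition related :: "'a model \<Rightarrow> 'a \<Rightarrow> 'a \<Rightarrow> 'a \<Rightarrow> bool" where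
  "related M r x y \<longleftrightarrow> (\<exists>p\<in>elts M r. is_pair M p x y)"

definition is_relation :: "'a model \<Rightarrow> 'a \<Rightarrow> bool" where
  "is_relation M r \<longleftrightarrow> is_set M r \<and> (\<forall>p\<in>elts M r. \<exists>x y. is_pair M p x y)"

definition rel_dom :: "'a model \<Rightarrow> 'a \<Rightarrow> 'a set" where
  "rel_dom M r = {x. \<exists>y. related M r x y}"

definition app :: "'a model \<Rightarrow> 'a \<Rightarrow> 'a \<Rightarrow> 'a" where
  "app M C X = (THE Y. related M C X Y)"

definition family_map :: "'a model \<Rightarrow> 'a \<Rightarrow> 'a set \<Rightarrow> 'a set \<Rightarrow> bool" where
  "family_map M C F G \<longleftrightarrow>
     is_set M C \<and> (\<forall>X\<in>F \<union> G. is_set M X) \<and>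
     (\<forall>p\<in>elts M C. \<exists>X\<in>F. \<exists>Y\<in>G. is_pair M p X Y) \<and>
     (\<forall>X\<in>F. \<exists>!Y. related M C X Y)"

definition coll :: "'a model \<Rightarrow> 'a set \<Rightarrow> 'a" where
  "coll M S = (THE v. is_set M v \<and> elts M v = S)"

definition pair :: "'a model \<Rightarrow> 'a \<Rightarrow> 'a \<Rightarrow> 'a" where
  "pair M x y = coll M {coll M {x}, coll M {x, y}}"

section \<open>The superstructure over the naturals\<close>

primrec stage :: "'a model \<Rightarrow> nat \<Rightarrow> 'a set" where
  "stage M 0 = elts M (nats M)"
| "stage M (Suc n) = stage M n \<union> {v. is_set M v \<and> elts M v \<subseteq> stage M n}"

text \<open>
  For \<open>h = \<infinity>\<close> this says that \<open>V\<close> is (isomorphic to) the superstructure over \<open>\<nat>\<close>.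
  It has \<open>beth_\<omega>\<close> elements, more than HOL proves any type to have. The finite
  heights \<open>h\<close>, for which \<open>V\<close> is the truncation to the stages \<open>0, \<dots>, h\<close>, are admitted
  as well; these have instances among the definable types. Transported sets of operators
  lie in stage 5, and binary relations on them in stage 7.
\<close>

definition superstructure :: "enat \<Rightarrow> (nat \<Rightarrow> 'v) \<Rightarrow> 'v model \<Rightarrow> bool" where
  "superstructure h atom V \<longleftrightarrow>
     inj atom \<and> elts V (nats V) = range atom \<and>
     (\<forall>n. elts V (atom n) = {}) \<and>
     (\<forall>a b. is_set V a \<and> is_set V b \<and> elts V a = elts V b \<longrightarrow> a = b) \<and>
     (\<forall>v. \<exists>n. enat n \<le> h \<and> v \<in> stage V n) \<and>
     (\<forall>n S. enat n < h \<and> S \<subseteq> stage V n \<longrightarrow> (\<exists>v. is_set V v \<and> elts V v = S))"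

section \<open>Nonstandard extensions\<close>

text \<open>Bounded formulas of the language of set theory, variables being numbered.\<close>

datatype bfm = Eq nat nat | In nat nat | Neg bfm | And bfm bfm | BAll nat nat bfm

primrec sat :: "'a model \<Rightarrow> (nat \<Rightarrow> 'a) \<Rightarrow> bfm \<Rightarrow> bool" where
  "sat M s (Eq i j) \<longleftrightarrow> s i = s j"
| "sat M s (In i j) \<longleftrightarrow> mem M (s i) (s j)"
| "sat M s (Neg f) \<longleftrightarrow> \<not> sat M s f"
| "sat M s (And f g) \<longleftrightarrow> sat M s f \<and> sat M s g"
| "sat M s (BAll i j f) \<longleftrightarrow> (\<forall>x. mem M x (s j) \<longrightarrow> sat M (s(i := x)) f)"

text \<open>
  Transfer is required for bounded formulas only, as is usual for superstructures;
  embeddings that are elementary for all first-order formulas are a special case.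
\<close>

definition elementary :: "'v model \<Rightarrow> 'w model \<Rightarrow> ('v \<Rightarrow> 'w) \<Rightarrow> bool" where
  "elementary V W star \<longleftrightarrow>
     nats W = star (nats V) \<and> (\<forall>f s. sat V s f \<longleftrightarrow> sat W (star \<circ> s) f)"

definition concurrent :: "'v model \<Rightarrow> 'v \<Rightarrow> bool" where
  "concurrent V r \<longleftrightarrow> is_relation V r \<and>
     (\<forall>A. finite A \<and> A \<subseteq> rel_dom V r \<longrightarrow> (\<exists>y. \<forall>x\<in>A. related V r x y))"

text \<open>
  Properness of the extension is not a separate clause: it follows from the second
  one, applied to the relation \<open>\<noteq>\<close> on the infinite set of atoms.
\<close>

definition enlargement :: "'v model \<Rightarrow> 'w model \<Rightarrow> ('v \<Rightarrow> 'w) \<Rightarrow> bool" where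
  "enlargement V W star \<longleftrightarrow> elementary V W star \<and>
     (\<forall>r. concurrent V r \<longrightarrow> (\<exists>b. \<forall>x\<in>rel_dom V r. related W (star r) (star x) b))"

definition sigma :: "'v model \<Rightarrow> ('v \<Rightarrow> 'w) \<Rightarrow> 'v \<Rightarrow> 'w set" where
  "sigma V star a = star ` elts V a"

text \<open>The *-finite objects: members of \<open>*F\<close> for a standard family \<open>F\<close> of finite sets.\<close>

definition star_finite :: "'v model \<Rightarrow> 'w model \<Rightarrow> ('v \<Rightarrow> 'w) \<Rightarrow> 'w \<Rightarrow> bool" where
  "star_finite V W star A \<longleftrightarrow>
     (\<exists>F. (\<forall>a\<in>elts V F. is_set V a \<and> finite (elts V a)) \<and> A \<in> elts W (star F))"

section \<open>Subtle consequence operators\<close>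

text \<open>
  The axioms (i), (ii), (iii) for a map \<open>C\<close> whose domain is the family \<open>F\<close>, with values
  included in the set \<open>K\<close>. In (i), \<open>C (C X)\<close> has to make sense, so \<open>C X\<close> is to lie in
  the domain. Axiom (iii) takes the notion of finiteness as an argument.
\<close>

definition ax1 :: "'a model \<Rightarrow> 'a \<Rightarrow> 'a set \<Rightarrow> 'a \<Rightarrow> bool" where
  "ax1 M C F K \<longleftrightarrow>
     (\<forall>X\<in>F. incl M X (app M C X) \<and> app M C X \<in> F \<and>
            app M C X = app M C (app M C X) \<and> incl M (app M C X) K)"

definition ax2 :: "'a model \<Rightarrow> 'a \<Rightarrow> 'a set \<Rightarrow> bool" where
  "ax2 M C F \<longleftrightarrow> (\<forall>X\<in>F. \<forall>Y\<in>F. incl M X Y \<longrightarrow> incl M (app M C X) (app M C Y))"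

definition ax3 :: "'a model \<Rightarrow> ('a \<Rightarrow> bool) \<Rightarrow> 'a \<Rightarrow> 'a set \<Rightarrow> bool" where
  "ax3 M fin C F \<longleftrightarrow>
     (\<forall>X\<in>F. elts M (app M C X) = (\<Union>A\<in>{A\<in>F. fin A \<and> incl M A X}. elts M (app M C A)))"

definition family_op :: "'a model \<Rightarrow> 'a \<Rightarrow> bool" where
  "family_op M C \<longleftrightarrow>
     (\<exists>F G K. family_map M C F G \<and> is_set M K \<and> ax1 M C F K \<and>
              (ax2 M C F \<or> ax3 M (\<lambda>A. finite (elts M A)) C F))"

text \<open>
  For an internal \<open>C\<close> all objects quantified over in (i) and (ii) are internal, so
  these axioms agree with their *-transfers. The *-transfer of (iii) has *-finite
  sets in place of finite ones; this is the second disjunct.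
\<close>

definition subtle :: "'v model \<Rightarrow> 'w model \<Rightarrow> ('v \<Rightarrow> 'w) \<Rightarrow> 'w \<Rightarrow> bool" where
  "subtle V W star C \<longleftrightarrow>
     family_op W C \<or>
     (\<exists>F G K. family_map W C F G \<and> is_set W K \<and> ax1 W C F K \<and>
              ax3 W (star_finite V W star) C F)"

definition purely_subtle :: "'v model \<Rightarrow> 'w model \<Rightarrow> ('v \<Rightarrow> 'w) \<Rightarrow> 'w \<Rightarrow> bool" where
  "purely_subtle V W star C \<longleftrightarrow> subtle V W star C \<and>
     \<not> (\<exists>D. family_op V D \<and> (elts W C = sigma V star D \<or> C = star D))"

section \<open>Transport into the superstructure\<close>

text \<open>
  The argument \<open>e\<close> is the identification of words with atoms. A set of words, an
  operator on the subsets of \<open>L\<close> and a set of operators become elements of \<open>V\<close>.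
\<close>

definition bold_set :: "'v model \<Rightarrow> ('a \<Rightarrow> 'v) \<Rightarrow> 'a set \<Rightarrow> 'v" where
  "bold_set V e X = coll V (e ` X)"

definition bold_Pow :: "'v model \<Rightarrow> ('a \<Rightarrow> 'v) \<Rightarrow> 'a set \<Rightarrow> 'v" where
  "bold_Pow V e L = coll V (bold_set V e ` Pow L)"

definition bold_op :: "'v model \<Rightarrow> ('a \<Rightarrow> 'v) \<Rightarrow> 'a set \<Rightarrow> ('a set \<Rightarrow> 'a set) \<Rightarrow> 'v" where
  "bold_op V e L C = coll V ((\<lambda>X. pair V (bold_set V e X) (bold_set V e (C X))) ` Pow L)"

definition bold_ops :: "'v model \<Rightarrow> ('a \<Rightarrow> 'v) \<Rightarrow> 'a set \<Rightarrow> ('a set \<Rightarrow> 'a set) set \<Rightarrow> 'v" where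
  "bold_ops V e L T = coll V (bold_op V e L ` T)"

text \<open>
  Pointwise inclusion on a family \<open>P\<close> of internal sets. For \<open>P\<close> the *-image of the
  power set of \<open>L\<close>, the members of \<open>P\<close> are the internal subsets of \<open>*L\<close>.
\<close>

definition star_le :: "'w model \<Rightarrow> 'w \<Rightarrow> 'w \<Rightarrow> 'w \<Rightarrow> bool" where
  "star_le W P C1 C2 \<longleftrightarrow> (\<forall>X\<in>elts W P. incl W (app W C1 X) (app W C2 X))"

definition star_less :: "'w model \<Rightarrow> 'w \<Rightarrow> 'w \<Rightarrow> 'w \<Rightarrow> bool" where
  "star_less W P C1 C2 \<longleftrightarrow> star_le W P C1 C2 \<and> C1 \<noteq> C2"

end

theory Submission
  imports Defs
begin

text \<open>
  Pointwise order on a set of operators lives in the superstructure as a binary relation,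
  which for a chain is concurrent; so is its strict part if the chain has no last element.
  The enlargement property supplies a single bound in the extension for all standard members,
  and transfer of the axioms makes every member of the extended chain a subtle operator.
  A strict bound is pure: it cannot be an extended standard operator, since that would be a
  member of the chain and hence strictly below itself, and it cannot be a copy \<open>\<sigma>D\<close>, since its
  domain contains the singleton of a nonstandard word.
\<close>

section \<open>Bounded formulas\<close>

definition Imp :: "bfm \<Rightarrow> bfm \<Rightarrow> bfm" where
  "Imp f g = Neg (And f (Neg g))"

definition BEx :: "nat \<Rightarrow> nat \<Rightarrow> bfm \<Rightarrow> bfm" where
  "BEx i j f = Neg (BAll i j (Neg f))"

text \<open>The bound variable exceeds every variable named as an argument, so nothing is captured;
  being positive, it also leaves variable 0 untouched. The formulas below choose fresh variables in
  the same way.\<close>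

definition Sub :: "nat \<Rightarrow> nat \<Rightarrow> bfm" where
  "Sub i j = BAll (Suc (i + j)) i (In (Suc (i + j)) j)"

definition Doubleton :: "nat \<Rightarrow> nat \<Rightarrow> nat \<Rightarrow> bfm" where
  "Doubleton u x y = And (In x u) (And (In y u)
     (BAll (Suc (u + x + y)) u
       (Imp (Neg (Eq (Suc (u + x + y)) x)) (Eq (Suc (u + x + y)) y))))"

text \<open>From here on, variable 0 stands for the set of atoms.\<close>

definition IsSet :: "nat \<Rightarrow> bfm" where
  "IsSet i = Neg (In i 0)"

text \<open>The existential quantifiers over \<open>u\<close> and \<open>v\<close> in
  \<open>is_pair\<close> can be bounded by \<open>p\<close>, because both objects are members of the
  pair.\<close>

definition IsPair :: "nat \<Rightarrow> nat \<Rightarrow> nat \<Rightarrow> bfm" where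
  "IsPair p x y = (let u = Suc (p + x + y); v = Suc u in
     BEx u p (BEx v p (And (IsSet u) (And (Doubleton u x x) (And (IsSet v)
       (And (Doubleton v x y) (And (IsSet p) (Doubleton p u v))))))))"

definition Related :: "nat \<Rightarrow> nat \<Rightarrow> nat \<Rightarrow> bfm" where
  "Related r x y = (let p = Suc (r + x + y) in BEx p r (IsPair p x y))"

lemma sat_Imp [simp]: "sat M s (Imp f g) \<longleftrightarrow> (sat M s f \<longrightarrow> sat M s g)"
  by (simp add: Imp_def)

lemma sat_BEx [simp]: "sat M s (BEx i j f) \<longleftrightarrow> (\<exists>x\<in>elts M (s j). sat M (s(i := x)) f)"
  by (auto simp: BEx_def elts_def)

lemma sat_Sub [simp]: "sat M s (Sub i j) \<longleftrightarrow> incl M (s i) (s j)"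
  by (auto simp: Sub_def incl_def elts_def)

lemma sat_Doubleton [simp]: "sat M s (Doubleton u x y) \<longleftrightarrow> elts M (s u) = {s x, s y}"
  by (auto simp: Doubleton_def elts_def)

lemma sat_IsSet [simp]: "s 0 = nats M \<Longrightarrow> sat M s (IsSet i) \<longleftrightarrow> is_set M (s i)"
  by (simp add: IsSet_def is_set_def)

lemma sat_IsPair [simp]:
  assumes "s 0 = nats M"
  shows "sat M s (IsPair p x y) \<longleftrightarrow> is_pair M (s p) (s x) (s y)"
  using assms by (auto simp: IsPair_def is_pair_def Let_def)

lemma sat_Related [simp]:
  assumes "s 0 = nats M"
  shows "sat M s (Related r x y) \<longleftrightarrow> related M (s r) (s x) (s y)"
  using assms by (simp add: Related_def related_def Let_def)

text \<open>Only the members of the sets involved matter here, so extensionality is not required.\<close>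

lemma is_pair_inject:
  assumes "is_pair M p x y" "is_pair M p x' y'"
  shows "x = x' \<and> y = y'"
proof -
  obtain u v where uv: "elts M u = {x}" "elts M v = {x, y}" "elts M p = {u, v}"
    using assms(1) unfolding is_pair_def by blast
  obtain u' v' where uv': "elts M u' = {x'}" "elts M v' = {x', y'}" "elts M p = {u', v'}"
    using assms(2) unfolding is_pair_def by blast
  have "u = u' \<and> v = v' \<or> u = v' \<and> v = u'"
    using uv(3) uv'(3) by (metis doubleton_eq_iff)
  then show ?thesis
    using uv uv' by (metis doubleton_eq_iff insert_absorb2)
qed

section \<open>Closure operators inside a model\<close>

text \<open>Axioms (i) and (ii) for the graph of a map from \<open>P\<close> to \<open>P\<close>.
  The description \<open>app\<close> is avoided and quantifiers range over members of
  \<open>P\<close> or \<open>C\<close>, so a bounded formula can express this; idempotence becomes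
  \<open>related M C Y Y\<close> for each value \<open>Y\<close>.\<close>

definition closure_relation :: "'a model \<Rightarrow> 'a \<Rightarrow> 'a \<Rightarrow> 'a \<Rightarrow> bool" where
  "closure_relation M P K C \<longleftrightarrow>
     is_set M C \<and>
     (\<forall>p\<in>elts M C. \<exists>X\<in>elts M P. \<exists>Y\<in>elts M P. is_pair M p X Y) \<and>
     (\<forall>X\<in>elts M P. \<exists>Y\<in>elts M P. related M C X Y) \<and>
     (\<forall>X\<in>elts M P. \<forall>Y\<in>elts M P. \<forall>Z\<in>elts M P.
        related M C X Y \<and> related M C X Z \<longrightarrow> Y = Z) \<and>
     (\<forall>X\<in>elts M P. \<forall>Y\<in>elts M P.
        related M C X Y \<longrightarrow> incl M X Y \<and> related M C Y Y \<and> incl M Y K) \<and>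
     (\<forall>X\<in>elts M P. \<forall>X'\<in>elts M P. \<forall>Y\<in>elts M P. \<forall>Y'\<in>elts M P.
        incl M X X' \<and> related M C X Y \<and> related M C X' Y' \<longrightarrow> incl M Y Y')"

text \<open>A relational substitute for \<open>star_le\<close>, free of \<open>app\<close> and
  therefore open to transfer.\<close>

definition pointwise_le :: "'a model \<Rightarrow> 'a \<Rightarrow> 'a \<Rightarrow> 'a \<Rightarrow> bool" where
  "pointwise_le M P C D \<longleftrightarrow>
     (\<forall>X\<in>elts M P. \<forall>Y\<in>elts M P. \<forall>Z\<in>elts M P.
        related M C X Y \<and> related M D X Z \<longrightarrow> incl M Y Z)"

text \<open>Variables 2, 3, 5, 6 stand for the family of sets, the bounding set and two operators.\<close>

definition ClosureRelation :: bfm where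
  "ClosureRelation =
     And (IsSet 5)
     (And (BAll 7 5 (BEx 8 2 (BEx 9 2 (IsPair 7 8 9))))
     (And (BAll 8 2 (BEx 9 2 (Related 5 8 9)))
     (And (BAll 8 2 (BAll 9 2 (BAll 10 2
            (Imp (And (Related 5 8 9) (Related 5 8 10)) (Eq 9 10)))))
     (And (BAll 8 2 (BAll 9 2
            (Imp (Related 5 8 9) (And (Sub 8 9) (And (Related 5 9 9) (Sub 9 3))))))
          (BAll 8 2 (BAll 9 2 (BAll 10 2 (BAll 11 2
            (Imp (And (Sub 8 9) (And (Related 5 8 10) (Related 5 9 11))) (Sub 10 11))))))))))"

definition PointwiseLe :: bfm where
  "PointwiseLe = BAll 8 2 (BAll 9 2 (BAll 10 2
     (Imp (And (Related 5 8 9) (Related 6 8 10)) (Sub 9 10))))"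

lemma sat_BAll_elts: "sat M s (BAll i j f) \<longleftrightarrow> (\<forall>x\<in>elts M (s j). sat M (s(i := x)) f)"
  by (simp add: elts_def)

lemma sat_ClosureRelation [simp]:
  assumes "s 0 = nats M"
  shows "sat M s ClosureRelation \<longleftrightarrow> closure_relation M (s 2) (s 3) (s 5)"
  using assms
  by (simp add: ClosureRelation_def closure_relation_def sat_BAll_elts del: sat.simps(5))

lemma sat_PointwiseLe [simp]:
  assumes "s 0 = nats M"
  shows "sat M s PointwiseLe \<longleftrightarrow> pointwise_le M (s 2) (s 5) (s 6)"
  using assms
  by (simp add: PointwiseLe_def pointwise_le_def sat_BAll_elts del: sat.simps(5))

lemma closure_relation_app:
  assumes C: "closure_relation M P K C" and X: "X \<in> elts M P"
  shows "app M C X \<in> elts M P" "related M C X Y \<longleftrightarrow> Y = app M C X"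
proof -
  \<comment> \<open>Single-valuedness is stated only for values in \<open>P\<close>. Members of
    \<open>C\<close> are pairs over \<open>P\<close>, and the components of a pair are unique, so no
    value lies outside.\<close>
  have rel_in: "Y \<in> elts M P" if "related M C X Y" for Y
    using that C is_pair_inject unfolding closure_relation_def related_def by metis
  obtain Y0 where Y0: "Y0 \<in> elts M P" "related M C X Y0"
    using C X unfolding closure_relation_def by blast
  have uniq: "Y = Y0" if "related M C X Y" for Y
    using that C X Y0 rel_in unfolding closure_relation_def by metis
  have "app M C X = Y0"
    unfolding app_def using Y0(2) uniq by (rule the_equality)
  then show "app M C X \<in> elts M P" "related M C X Y \<longleftrightarrow> Y = app M C X"
    using Y0 uniq by blast+
qed

text \<open>Domain and codomain families are both \<open>elts M P\<close>; monotonicity settles the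
  disjunction in \<open>family_op\<close> through (ii).\<close>

lemma closure_relation_family_op:
  assumes C: "closure_relation M P K C" and P: "\<forall>X\<in>elts M P. is_set M X" and K: "is_set M K"
  shows "family_op M C"
proof -
  note app = closure_relation_app [OF C]
  have "family_map M C (elts M P) (elts M P)"
    using C P app(2) unfolding family_map_def closure_relation_def by auto
  moreover have "ax1 M C (elts M P) K"
    using C app unfolding ax1_def closure_relation_def by metis
  moreover have "ax2 M C (elts M P)"
    unfolding ax2_def
  proof (intro ballI impI)
    fix X Y assume XY: "X \<in> elts M P" "Y \<in> elts M P" "incl M X Y"
    have mono: "\<forall>X\<in>elts M P. \<forall>X'\<in>elts M P. \<forall>Y\<in>elts M P. \<forall>Y'\<in>elts M P.
        incl M X X' \<and> related M C X Y \<and> related M C X' Y' \<longrightarrow> incl M Y Y'"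
      using C unfolding closure_relation_def by (elim conjE)
    show "incl M (app M C X) (app M C Y)"
      using mono [rule_format, OF XY(1,2) app(1) [OF XY(1)] app(1) [OF XY(2)]] XY app(2) by simp
  qed
  ultimately show ?thesis
    using K unfolding family_op_def by blast
qed

lemma closure_relation_star_le:
  assumes "closure_relation M P K C" "closure_relation M P K' D" "pointwise_le M P C D"
  shows "star_le M P C D"
  unfolding star_le_def
proof
  fix X assume X: "X \<in> elts M P"
  note app = closure_relation_app [OF assms(1) X] closure_relation_app [OF assms(2) X]
  have "related M C X (app M C X)" "related M D X (app M D X)"
    using app(2,4) by simp_all
  then show "incl M (app M C X) (app M D X)"
    using assms(3) X app(1,3) unfolding pointwise_le_def by blast
qed

section \<open>Transfer\<close>

lemma elementary_sat:
  "elementary V W star \<Longrightarrow> sat W (star \<circ> s) f \<longleftrightarrow> sat V s f"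
  by (simp add: elementary_def)

lemma elementary_nats: "elementary V W star \<Longrightarrow> nats W = star (nats V)"
  by (simp add: elementary_def)

lemma elementary_mem: "elementary V W star \<Longrightarrow> star x \<in> elts W (star y) \<longleftrightarrow> x \<in> elts V y"
  using elementary_sat [of V W star "\<lambda>i. if i = 0 then x else y" "In 0 1"]
  by (simp add: elts_def)

lemma elementary_is_set: "elementary V W star \<Longrightarrow> is_set W (star x) \<longleftrightarrow> is_set V x"
  using elementary_mem [of V W star x "nats V"]
  by (simp add: is_set_def elts_def elementary_nats)

lemma elementary_is_pair:
  assumes "elementary V W star"
  shows "is_pair W (star p) (star x) (star y) \<longleftrightarrow> is_pair V p x y"
  using elementary_sat [OF assms, of "(\<lambda>_. nats V)(2 := p, 3 := x, 4 := y)" "IsPair 2 3 4"]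
  by (simp add: elementary_nats [OF assms])

text \<open>Nonemptiness transfers down to \<open>a\<close>, and the star-image of any member of
  \<open>a\<close> can only be \<open>b\<close>.\<close>

lemma elementary_singleton:
  assumes "elementary V W star" "elts W (star a) = {b}"
  shows "b \<in> star ` elts V a"
proof -
  \<comment> \<open>The formula just says that the set in variable 1 is nonempty.\<close>
  have "sat W (star \<circ> (\<lambda>_. a)) (BEx 0 1 (Eq 0 0))"
    using assms(2) by simp
  then have "sat V (\<lambda>_. a) (BEx 0 1 (Eq 0 0))"
    by (simp only: elementary_sat [OF assms(1)])
  then obtain c where "c \<in> elts V a"
    by auto
  then show ?thesis
    using assms elementary_mem by (metis image_eqI singletonD)
qed

section \<open>Sets in the superstructure\<close>

text \<open>Completeness of the stages below \<open>h\<close> gives existence and extensionality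
  gives uniqueness, so the description in \<open>coll\<close> denotes.\<close>

lemma superstructure_coll:
  assumes "superstructure h atom V" "S \<subseteq> stage V n" "enat n < h"
  shows "is_set V (coll V S) \<and> elts V (coll V S) = S"
proof -
  obtain v where v: "is_set V v" "elts V v = S"
    using assms unfolding superstructure_def by blast
  have "w = v" if "is_set V w \<and> elts V w = S" for w
    using that v assms(1) unfolding superstructure_def by blast
  then have "coll V S = v"
    unfolding coll_def using v by (intro the_equality) blast+
  then show ?thesis
    using v by simp
qed

lemma superstructure_coll_stage:
  assumes "superstructure h atom V" "S \<subseteq> stage V n" "enat n < h"
  shows "coll V S \<in> stage V (Suc n)"
  using superstructure_coll [OF assms] assms(2) by simp

text \<open>A Kuratowski pair costs two stages: its two members lie one stage above the components,
  and the pair one stage above them.\<close>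

lemma superstructure_pair:
  assumes V: "superstructure h atom V" and xy: "x \<in> stage V n" "y \<in> stage V n"
    and h: "enat (Suc n) < h"
  shows "is_pair V (pair V x y) x y" "pair V x y \<in> stage V (Suc (Suc n))"
proof -
  have n: "enat n < h"
    using h by (meson enat_ord_simps(2) lessI less_trans)
  have stages: "coll V {x} \<in> stage V (Suc n)" "coll V {x, y} \<in> stage V (Suc n)"
    using superstructure_coll_stage [OF V _ n] xy by simp_all
  show "is_pair V (pair V x y) x y"
    unfolding is_pair_def pair_def
    using superstructure_coll [OF V _ n, of "{x}"] superstructure_coll [OF V _ n, of "{x, y}"]
      superstructure_coll [OF V _ h, of "{coll V {x}, coll V {x, y}}"] xy stages
    by (intro exI [of _ "coll V {x}"] exI [of _ "coll V {x, y}"]) (simp del: stage.simps)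
  show "pair V x y \<in> stage V (Suc (Suc n))"
    unfolding pair_def using superstructure_coll_stage [OF V _ h] stages by simp
qed

text \<open>
  A formula \<open>f\<close> in the variables 5 and 6 defines a relation on \<open>a\<close>; variable 4, which holds
  \<open>a\<close>, and variable 7, which is overwritten by the code of the relation, are auxiliary.
\<close>

lemma enlargement_bound:
  assumes V: "superstructure h atom V" and VW: "enlargement V W star"
    and a: "elts V a \<subseteq> stage V n" "enat (Suc (Suc n)) < h"
    and s: "s 0 = nats V" "s 4 = a"
    and R: "\<And>r x y. sat V (s(7 := r, 5 := x, 6 := y)) f \<longleftrightarrow> R x y"
    and R': "\<And>r x y. sat W ((star \<circ> s)(7 := r, 5 := x, 6 := y)) f \<longleftrightarrow> R' x y"
    and bound: "\<And>B. finite B \<Longrightarrow> B \<subseteq> elts V a \<Longrightarrow> \<exists>y\<in>elts V a. \<forall>x\<in>B. R x y"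
  obtains b where "b \<in> elts W (star a)" "\<And>x. x \<in> elts V a \<Longrightarrow> R' (star x) b"
proof -
  have E: "elementary V W star"
    using VW by (simp add: enlargement_def)
  define A where "A = elts V a"
  \<comment> \<open>\<open>r\<close> codes \<open>R\<close> restricted to \<open>A\<close>. Its
    members lie two stages above those of \<open>A\<close>, which is where the height assumption
    enters.\<close>
  define S where "S = {pair V x y |x y. x \<in> A \<and> y \<in> A \<and> R x y}"
  define r where "r = coll V S"
  have n: "enat (Suc n) < h"
    using a(2) by (meson enat_ord_simps(2) lessI less_trans)
  have pair: "is_pair V (pair V x y) x y" "pair V x y \<in> stage V (Suc (Suc n))"
    if "x \<in> A" "y \<in> A" for x y
    using superstructure_pair [OF V _ _ n] that a(1) unfolding A_def by blast+
  have "S \<subseteq> stage V (Suc (Suc n))"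
    unfolding S_def using pair(2) by blast
  from superstructure_coll [OF V this a(2)] have r: "is_set V r" "elts V r = S"
    unfolding r_def by auto
  have related: "related V r x y \<longleftrightarrow> x \<in> A \<and> y \<in> A \<and> R x y" for x y
  proof
    assume "related V r x y"
    then obtain x' y' where "is_pair V (pair V x' y') x y" "x' \<in> A" "y' \<in> A" "R x' y'"
      unfolding related_def r(2) S_def by blast
    then show "x \<in> A \<and> y \<in> A \<and> R x y"
      using is_pair_inject [OF pair(1)] by metis
  next
    assume "x \<in> A \<and> y \<in> A \<and> R x y"
    then show "related V r x y"
      unfolding related_def r(2) S_def using pair(1) by blast
  qed
  \<comment> \<open>Bounds for singletons put all of \<open>A\<close> into the domain of
    \<open>r\<close>, so the enlargement property speaks about every member of
    \<open>A\<close>.\<close>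
  have "\<exists>y\<in>A. R x y" if "x \<in> A" for x
    using bound [of "{x}"] that by (simp add: A_def)
  then have dom: "rel_dom V r = A"
    unfolding rel_dom_def related by blast
  have "is_relation V r"
    unfolding is_relation_def r(2) using r(1) pair(1) unfolding S_def by blast
  moreover have "\<exists>y. \<forall>x\<in>B. related V r x y" if "finite B" "B \<subseteq> A" for B
    using bound [of B] that unfolding related A_def by blast
  ultimately have "concurrent V r"
    unfolding concurrent_def dom by blast
  then obtain b where b: "\<And>x. x \<in> A \<Longrightarrow> related W (star r) (star x) b"
    using VW dom unfolding enlargement_def by blast
  \<comment> \<open>So far \<open>b\<close> is an arbitrary object of the extension. Transfer of
    \<open>?g\<close>, that \<open>r\<close> consists of pairs over \<open>a\<close>, will place it
    in \<open>star a\<close>; transfer of \<open>?k\<close>, that related objects satisfy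
    \<open>f\<close>, will give \<open>R'\<close>.\<close>
  let ?g = "BAll 8 7 (BEx 5 4 (BEx 6 4 (IsPair 8 5 6)))"
  let ?k = "BAll 5 4 (BAll 6 4 (Imp (Related 7 5 6) f))"
  have s': "star (s 0) = nats W" "star \<circ> s(7 := r) = (star \<circ> s)(7 := star r)"
    using s elementary_nats [OF E] by auto
  have "sat V (s(7 := r)) ?g"
    using s pair(1) by (auto simp: sat_BAll_elts r(2) S_def A_def simp del: sat.simps(5))
  then have "sat W (star \<circ> s(7 := r)) ?g"
    by (simp only: elementary_sat [OF E])
  then have pairs: "\<forall>p\<in>elts W (star r). \<exists>x\<in>elts W (star a). \<exists>y\<in>elts W (star a). is_pair W p x y"
    unfolding s'(2) using s s'(1) by (simp add: sat_BAll_elts del: sat.simps(5))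
  have "sat V (s(7 := r)) ?k"
    using s by (simp add: sat_BAll_elts R related del: sat.simps(5))
  then have "sat W (star \<circ> s(7 := r)) ?k"
    by (simp only: elementary_sat [OF E])
  then have rel: "\<forall>x\<in>elts W (star a). \<forall>y\<in>elts W (star a). related W (star r) x y \<longrightarrow> R' x y"
    unfolding s'(2) using s s'(1) by (simp add: sat_BAll_elts R' del: sat.simps(5))
  have bx: "b \<in> elts W (star a) \<and> R' (star x) b" if "x \<in> A" for x
    using b [OF that] pairs rel is_pair_inject unfolding related_def by metis
  \<comment> \<open>Membership of \<open>b\<close> in \<open>star a\<close> was derived from some
    \<open>x \<in> A\<close>; the bound for the empty set provides such an \<open>x\<close>.\<close>
  moreover have "A \<noteq> {}"
    using bound [of "{}"] by (auto simp: A_def)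
  ultimately show thesis
    using that unfolding A_def by blast
qed

section \<open>Transported operators\<close>

lemma cons_opD:
  assumes "cons_op L C" "X \<subseteq> L"
  shows "X \<subseteq> C X" "C (C X) = C X" "C X \<subseteq> L"
    and "\<And>Y. Y \<subseteq> L \<Longrightarrow> X \<subseteq> Y \<Longrightarrow> C X \<subseteq> C Y"
  using assms by (auto simp: cons_op_def)

lemma cons_op_eqI:
  assumes C: "cons_op L C" and D: "cons_op L D" and eq: "\<And>X. X \<subseteq> L \<Longrightarrow> C X = D X"
  shows "C = D"
  using C D eq unfolding cons_op_def by (intro PiE_ext [of C "Pow L" "\<lambda>_. Pow L" D]) auto

lemma op_le_trans: "op_le L C D \<Longrightarrow> op_le L D E \<Longrightarrow> op_le L C E"
  by (fastforce simp: op_le_def)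

lemma op_le_antisym:
  "cons_op L C \<Longrightarrow> cons_op L D \<Longrightarrow> op_le L C D \<Longrightarrow> op_le L D C \<Longrightarrow> C = D"
  by (rule cons_op_eqI) (auto simp: op_le_def)

lemma op_le_less_trans:
  assumes "cons_op L C" "cons_op L D" "op_le L C D" "op_less L D E"
  shows "op_less L C E"
  using assms op_le_trans op_le_antisym unfolding op_less_def by metis

text \<open>Induction on \<open>B\<close>: the new operator is comparable with the bound found so
  far, and the larger of the two serves. Nonemptiness of \<open>T\<close> settles the base
  case.\<close>

lemma chain_finite_upper_bound:
  assumes chain: "Complete_Partial_Order.chain (op_le L) T" and "T \<noteq> {}"
    and "finite B" "B \<subseteq> T"
  shows "\<exists>D\<in>T. \<forall>C\<in>B. op_le L C D"
  using \<open>finite B\<close> \<open>B \<subseteq> T\<close>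
proof (induction B)
  case empty
  then show ?case
    using \<open>T \<noteq> {}\<close> by blast
next
  case (insert E B)
  then obtain D where D: "D \<in> T" "\<forall>C\<in>B. op_le L C D"
    by auto
  have "op_le L D E \<or> op_le L E D"
    using chainD [OF chain D(1), of E] insert.prems by blast
  moreover have "op_le L E E"
    by (simp add: op_le_def)
  ultimately show ?case
    using D insert.prems op_le_trans by (metis insert_iff subset_iff)
qed

section \<open>Codes of sets, operators and families in the superstructure\<close>

locale transport =
  fixes h :: enat and atom :: "nat \<Rightarrow> 'v" and V :: "'v model" and e :: "'a \<Rightarrow> 'v" and L :: "'a set"
  assumes V: "superstructure h atom V" and h: "7 \<le> h"
    and inj_e: "inj_on e L" and e_atom: "e ` L \<subseteq> elts V (nats V)"
begin

abbreviation bP where "bP \<equiv> bold_Pow V e L"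
abbreviation bL where "bL \<equiv> bold_set V e L"

text \<open>Stage count behind the number 7: words 0, sets of words 1, pairs of these 3, operators
  4, pairs of operators 6, a relation between operators 7.\<close>

lemma height: "n < 7 \<Longrightarrow> enat n < h"
  using h by (metis enat_ord_simps(2) numeral_eq_enat order_less_le_trans)

lemma bold_set:
  assumes "X \<subseteq> L"
  shows "is_set V (bold_set V e X)" "elts V (bold_set V e X) = e ` X"
    and "bold_set V e X \<in> stage V 1"
proof -
  have X: "e ` X \<subseteq> stage V 0"
    using assms e_atom by auto
  show "is_set V (bold_set V e X)" "elts V (bold_set V e X) = e ` X"
    unfolding bold_set_def using superstructure_coll [OF V X height] by auto
  show "bold_set V e X \<in> stage V 1"
    unfolding bold_set_def One_nat_def by (rule superstructure_coll_stage [OF V X height]) simp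
qed

lemma incl_bold_set:
  "X \<subseteq> L \<Longrightarrow> Y \<subseteq> L \<Longrightarrow> incl V (bold_set V e X) (bold_set V e Y) \<longleftrightarrow> X \<subseteq> Y"
  using inj_on_image_mem_iff [OF inj_e]
  by (simp add: incl_def bold_set(2) image_subset_iff) blast

lemma bold_set_inject:
  "X \<subseteq> L \<Longrightarrow> Y \<subseteq> L \<Longrightarrow> bold_set V e X = bold_set V e Y \<longleftrightarrow> X = Y"
  using incl_bold_set [of X Y] incl_bold_set [of Y X] by (auto simp: incl_def)

lemma bold_Pow: "elts V bP = bold_set V e ` Pow L"
proof -
  have "bold_set V e ` Pow L \<subseteq> stage V 1"
    using bold_set(3) by blast
  from superstructure_coll [OF V this height] show ?thesis
    unfolding bold_Pow_def by simp
qed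

lemma bold_op:
  assumes C: "cons_op L C"
  shows "is_set V (bold_op V e L C)"
    and "elts V (bold_op V e L C) = (\<lambda>X. pair V (bold_set V e X) (bold_set V e (C X))) ` Pow L"
    and "bold_op V e L C \<in> stage V 4"
proof -
  have X: "(\<lambda>X. pair V (bold_set V e X) (bold_set V e (C X))) ` Pow L \<subseteq> stage V 3"
    using superstructure_pair(2) [OF V bold_set(3) bold_set(3) height] cons_opD(3) [OF C]
    by (auto simp: numeral_3_eq_3 simp del: stage.simps)
  show "is_set V (bold_op V e L C)"
    and "elts V (bold_op V e L C) = (\<lambda>X. pair V (bold_set V e X) (bold_set V e (C X))) ` Pow L"
    unfolding bold_op_def using superstructure_coll [OF V X height] by auto
  show "bold_op V e L C \<in> stage V 4"
    unfolding bold_op_def using superstructure_coll_stage [OF V X height]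
    by (simp add: eval_nat_numeral del: stage.simps)
qed

lemma bold_ops:
  assumes T: "\<forall>C\<in>T. cons_op L C"
  shows "elts V (bold_ops V e L T) = bold_op V e L ` T" "elts V (bold_ops V e L T) \<subseteq> stage V 4"
proof -
  have T: "bold_op V e L ` T \<subseteq> stage V 4"
    using T bold_op(3) by blast
  from superstructure_coll [OF V T height] show "elts V (bold_ops V e L T) = bold_op V e L ` T"
    unfolding bold_ops_def by simp
  with T show "elts V (bold_ops V e L T) \<subseteq> stage V 4"
    by simp
qed

lemma is_pair_bold:
  assumes "X \<subseteq> L" "Y \<subseteq> L"
  shows "is_pair V (pair V (bold_set V e X) (bold_set V e Y)) (bold_set V e X) (bold_set V e Y)"
  using superstructure_pair(1) [OF V bold_set(3) bold_set(3) height] assms by simp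

text \<open>A pair determines its components and \<open>bold_set\<close> determines its argument, so
  the value is unique even among arbitrary objects \<open>y\<close>.\<close>

lemma related_bold_op:
  assumes C: "cons_op L C" and X: "X \<subseteq> L"
  shows "related V (bold_op V e L C) (bold_set V e X) y \<longleftrightarrow> y = bold_set V e (C X)"
proof
  assume "related V (bold_op V e L C) (bold_set V e X) y"
  then obtain X' where X': "X' \<subseteq> L"
      "is_pair V (pair V (bold_set V e X') (bold_set V e (C X'))) (bold_set V e X) y"
    unfolding related_def bold_op(2) [OF C] by blast
  then have "bold_set V e X' = bold_set V e X \<and> bold_set V e (C X') = y"
    using is_pair_inject is_pair_bold cons_opD(3) [OF C] by metis
  then show "y = bold_set V e (C X)"
    using bold_set_inject X X'(1) by blast
next
  assume "y = bold_set V e (C X)"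
  then show "related V (bold_op V e L C) (bold_set V e X) y"
    unfolding related_def bold_op(2) [OF C] using is_pair_bold X cons_opD(3) [OF C] by blast
qed

lemma closure_relation_bold_op:
  assumes C: "cons_op L C"
  shows "closure_relation V bP bL (bold_op V e L C)"
  \<comment> \<open>Quantifiers over members of the coded power set turn into quantifiers over
    \<open>Pow L\<close>.\<close>
  unfolding closure_relation_def bold_Pow ball_simps bex_simps
proof (intro conjI)
  show "is_set V (bold_op V e L C)"
    by (rule bold_op(1) [OF C])
  show "\<forall>p\<in>elts V (bold_op V e L C).
      \<exists>X\<in>Pow L. \<exists>Y\<in>Pow L. is_pair V p (bold_set V e X) (bold_set V e Y)"
    unfolding bold_op(2) [OF C] using is_pair_bold cons_opD(3) [OF C] by blast
  show "\<forall>X\<in>Pow L. \<exists>Y\<in>Pow L. related V (bold_op V e L C) (bold_set V e X) (bold_set V e Y)"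
    using related_bold_op [OF C] cons_opD(3) [OF C] by blast
\<comment> \<open>What remains is single-valuedness and the axioms (i) and (ii), read off from those
  of \<open>C\<close>.\<close>
qed (use related_bold_op [OF C] cons_opD [OF C] incl_bold_set in \<open>auto simp: Ball_def\<close>)

lemma pointwise_le_bold_op:
  assumes C: "cons_op L C" and D: "cons_op L D"
  shows "pointwise_le V bP (bold_op V e L C) (bold_op V e L D) \<longleftrightarrow> op_le L C D"
proof -
  have "related V (bold_op V e L C) (bold_set V e X) (bold_set V e Y) \<and>
      related V (bold_op V e L D) (bold_set V e X) (bold_set V e Z) \<longleftrightarrow> Y = C X \<and> Z = D X"
    if "X \<subseteq> L" "Y \<subseteq> L" "Z \<subseteq> L" for X Y Z
    using that cons_opD(3) [OF C] cons_opD(3) [OF D]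
    by (simp add: related_bold_op [OF C] related_bold_op [OF D] bold_set_inject)
  then have "pointwise_le V bP (bold_op V e L C) (bold_op V e L D) \<longleftrightarrow>
      (\<forall>X\<in>Pow L. \<forall>Y\<in>Pow L. \<forall>Z\<in>Pow L. Y = C X \<and> Z = D X \<longrightarrow> Y \<subseteq> Z)"
    unfolding pointwise_le_def bold_Pow by (simp add: incl_bold_set)
  then show ?thesis
    unfolding op_le_def using cons_opD(3) [OF C] cons_opD(3) [OF D] by (metis PowD PowI)
qed

text \<open>This carries strictness from operators to their codes.\<close>

lemma bold_op_inject:
  assumes C: "cons_op L C" and D: "cons_op L D" and eq: "bold_op V e L C = bold_op V e L D"
  shows "C = D"
proof (rule cons_op_eqI [OF C D])
  fix X assume X: "X \<subseteq> L"
  have "bold_set V e (C X) = bold_set V e (D X)"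
    using related_bold_op [OF C X] related_bold_op [OF D X] eq by metis
  then show "C X = D X"
    using bold_set_inject cons_opD(3) [OF C X] cons_opD(3) [OF D X] by blast
qed

end

section \<open>Transfer of coded operators to the extension\<close>

locale nonstandard_transport = transport h atom V e L
  for h atom and V :: "'v model" and e :: "'a \<Rightarrow> 'v" and L +
  fixes W :: "'w model" and star :: "'v \<Rightarrow> 'w"
  assumes VW: "enlargement V W star"
begin

lemma E: "elementary V W star"
  using VW by (simp add: enlargement_def)

text \<open>The remaining variables hold the dummy \<open>nats V\<close>, which is overwritten
  before any of them is read.\<close>

definition env :: "'v \<Rightarrow> nat \<Rightarrow> 'v" where
  "env a = (\<lambda>_. nats V)(2 := bP, 3 := bL, 4 := a)"

lemma env [simp]: "env a 0 = nats V" "env a 2 = bP" "env a 3 = bL" "env a 4 = a"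
  by (simp_all add: env_def)

lemma star_bP_is_set: "\<forall>X\<in>elts W (star bP). is_set W X"
proof -
  have "sat V (env bP) (BAll 5 2 (IsSet 5))"
    using bold_set(1) by (auto simp: sat_BAll_elts bold_Pow simp del: sat.simps(5))
  then have "sat W (star \<circ> env bP) (BAll 5 2 (IsSet 5))"
    by (simp only: elementary_sat [OF E])
  then show ?thesis
    by (simp add: sat_BAll_elts elementary_nats [OF E] del: sat.simps(5))
qed

lemma star_bL_is_set: "is_set W (star bL)"
  using elementary_is_set [OF E] bold_set(1) by simp

text \<open>One quantifier over the coded family, held in variable 4, keeps the statement bounded;
  its transfer reaches the nonstandard members as well.\<close>

lemma closure_relation_star_ops:
  assumes T: "\<forall>C\<in>T. cons_op L C" and C: "C \<in> elts W (star (bold_ops V e L T))"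
  shows "closure_relation W (star bP) (star bL) C"
proof -
  have "sat V (env (bold_ops V e L T)) (BAll 5 4 ClosureRelation)"
    using T closure_relation_bold_op
    by (auto simp: sat_BAll_elts bold_ops simp del: sat.simps(5))
  then have "sat W (star \<circ> env (bold_ops V e L T)) (BAll 5 4 ClosureRelation)"
    by (simp only: elementary_sat [OF E])
  then show ?thesis
    using C by (simp add: sat_BAll_elts elementary_nats [OF E] del: sat.simps(5))
qed

lemma closure_relation_star_op:
  "cons_op L C \<Longrightarrow> closure_relation W (star bP) (star bL) (star (bold_op V e L C))"
  \<comment> \<open>The star-image of the code of \<open>{C}\<close> contains the star-image of the
    code of \<open>C\<close>.\<close>
  by (rule closure_relation_star_ops [of "{C}"]) (simp_all add: elementary_mem [OF E] bold_ops)

text \<open>The transferred (i) and (ii) are the same axioms for the internal operator, so the first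
  alternative of \<open>subtle\<close> applies.\<close>

lemma subtle_star_ops:
  "\<forall>C\<in>T. cons_op L C \<Longrightarrow> C \<in> elts W (star (bold_ops V e L T)) \<Longrightarrow> subtle V W star C"
  unfolding subtle_def
  by (intro disjI1 closure_relation_family_op [OF closure_relation_star_ops]
      star_bP_is_set star_bL_is_set)

section \<open>Upper bounds from the enlargement property\<close>

lemma star_upper_bound:
  assumes T: "\<forall>C\<in>T. cons_op L C" and "T \<noteq> {}"
    and chain: "Complete_Partial_Order.chain (op_le L) T"
  obtains C0 where "C0 \<in> elts W (star (bold_ops V e L T))"
    "\<And>C. C \<in> T \<Longrightarrow> star_le W (star bP) (star (bold_op V e L C)) C0"
proof -
  have bound: "\<exists>y\<in>elts V (bold_ops V e L T). \<forall>x\<in>B. pointwise_le V bP x y"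
    if B: "finite B" "B \<subseteq> elts V (bold_ops V e L T)" for B
  proof -
    \<comment> \<open>A finite set of codes comes from finitely many operators, to which the chain
      property applies.\<close>
    obtain B' where B': "finite B'" "B' \<subseteq> T" "B = bold_op V e L ` B'"
      using B finite_subset_image unfolding bold_ops(1) [OF T] by metis
    then obtain D where D: "D \<in> T" "\<forall>C\<in>B'. op_le L C D"
      using chain_finite_upper_bound [OF chain \<open>T \<noteq> {}\<close>] by metis
    then have "pointwise_le V bP (bold_op V e L C) (bold_op V e L D)" if "C \<in> B'" for C
      using that B'(2) T pointwise_le_bold_op by blast
    then show ?thesis
      unfolding B'(3) bold_ops(1) [OF T] using D(1) by blast
  qed
  obtain C0 where C0: "C0 \<in> elts W (star (bold_ops V e L T))"
    "\<And>x. x \<in> elts V (bold_ops V e L T) \<Longrightarrow> pointwise_le W (star bP) (star x) C0"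
    by (rule enlargement_bound [OF V VW bold_ops(2) [OF T] height,
          where s = "env (bold_ops V e L T)" and f = PointwiseLe
            and R = "pointwise_le V bP" and R' = "pointwise_le W (star bP)"])
      (use bound in \<open>simp_all add: elementary_nats [OF E]\<close>)
  show thesis
  proof (rule that [OF C0(1)])
    fix C assume "C \<in> T"
    then have "cons_op L C" "bold_op V e L C \<in> elts V (bold_ops V e L T)"
      using T bold_ops(1) [OF T] by simp_all
    then show "star_le W (star bP) (star (bold_op V e L C)) C0"
      using closure_relation_star_le [OF closure_relation_star_op
          closure_relation_star_ops [OF T C0(1)]] C0(2) by simp
  qed
qed

lemma star_strict_upper_bound:
  assumes T: "\<forall>C\<in>T. cons_op L C" and "T \<noteq> {}"
    and chain: "Complete_Partial_Order.chain (op_le L) T"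
    and unbounded: "\<forall>C\<in>T. \<exists>C'\<in>T. op_less L C C'"
  obtains C0 where "C0 \<in> elts W (star (bold_ops V e L T))"
    "\<And>C. C \<in> T \<Longrightarrow> star_less W (star bP) (star (bold_op V e L C)) C0"
proof -
  have bound: "\<exists>y\<in>elts V (bold_ops V e L T). \<forall>x\<in>B. pointwise_le V bP x y \<and> x \<noteq> y"
    if B: "finite B" "B \<subseteq> elts V (bold_ops V e L T)" for B
  proof -
    obtain B' where B': "finite B'" "B' \<subseteq> T" "B = bold_op V e L ` B'"
      using B finite_subset_image unfolding bold_ops(1) [OF T] by metis
    then obtain D where D: "D \<in> T" "\<forall>C\<in>B'. op_le L C D"
      using chain_finite_upper_bound [OF chain \<open>T \<noteq> {}\<close>] by metis
    \<comment> \<open>\<open>D\<close> may itself belong to \<open>B'\<close>; an operator strictly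
      above it makes all the inequalities strict.\<close>
    then obtain D' where D': "D' \<in> T" "op_less L D D'"
      using unbounded by blast
    have "pointwise_le V bP (bold_op V e L C) (bold_op V e L D') \<and>
        bold_op V e L C \<noteq> bold_op V e L D'" if "C \<in> B'" for C
    proof -
      have C: "cons_op L C" and D'': "cons_op L D'"
        using that B'(2) T D'(1) by blast+
      have "op_less L C D'"
        using op_le_less_trans [OF C _ _ D'(2)] D T that by blast
      then show ?thesis
        using pointwise_le_bold_op [OF C D''] bold_op_inject [OF C D'']
        unfolding op_less_def by blast
    qed
    then show ?thesis
      unfolding B'(3) bold_ops(1) [OF T] using D'(1)
      by (intro bexI [of _ "bold_op V e L D'"]) simp_all
  qed
  \<comment> \<open>The conjunct \<open>Neg (Eq 5 6)\<close> carries distinctness through the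
    enlargement.\<close>
  obtain C0 where C0: "C0 \<in> elts W (star (bold_ops V e L T))"
    "\<And>x. x \<in> elts V (bold_ops V e L T) \<Longrightarrow> pointwise_le W (star bP) (star x) C0 \<and> star x \<noteq> C0"
    by (rule enlargement_bound [OF V VW bold_ops(2) [OF T] height,
          where s = "env (bold_ops V e L T)" and f = "And PointwiseLe (Neg (Eq 5 6))"
            and R = "\<lambda>x y. pointwise_le V bP x y \<and> x \<noteq> y"
            and R' = "\<lambda>x y. pointwise_le W (star bP) x y \<and> x \<noteq> y"])
      (use bound in \<open>simp_all add: elementary_nats [OF E]\<close>)
  show thesis
  proof (rule that [OF C0(1)])
    fix C assume "C \<in> T"
    then have "cons_op L C" "bold_op V e L C \<in> elts V (bold_ops V e L T)"
      using T bold_ops(1) [OF T] by simp_all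
    then show "star_less W (star bP) (star (bold_op V e L C)) C0"
      unfolding star_less_def
      using closure_relation_star_le [OF closure_relation_star_op
          closure_relation_star_ops [OF T C0(1)]] C0(2) by simp
  qed
qed

section \<open>Nonstandard words and pure subtlety\<close>

lemma nonstandard_word:
  assumes "infinite L"
  obtains b where "b \<in> elts W (star bL)" "b \<notin> star ` elts V bL"
proof -
  have bL: "elts V bL \<subseteq> stage V 0" "infinite (elts V bL)"
    using e_atom assms finite_imageD [OF _ inj_e] by (auto simp: bold_set(2))
  \<comment> \<open>No finite set exhausts the infinite \<open>L\<close>, so inequality on words is
    concurrent and its bound \<open>b\<close> differs from every standard word.\<close>
  have bound: "\<exists>y\<in>elts V bL. \<forall>x\<in>B. x \<noteq> y" if "finite B" for B
    using bL(2) that by (metis finite_subset subsetI)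
  obtain b where "b \<in> elts W (star bL)" "\<And>x. x \<in> elts V bL \<Longrightarrow> star x \<noteq> b"
    by (rule enlargement_bound [OF V VW bL(1) height, where s = "env bL" and f = "Neg (Eq 5 6)"
          and R = "\<lambda>x y. x \<noteq> y" and R' = "\<lambda>x y. x \<noteq> y"])
      (use bound in simp_all)
  then show thesis
    using that by blast
qed

text \<open>By transfer the singleton of a nonstandard word is an internal subset of the extended
  \<open>L\<close>; were it standard, its only member would be standard too.\<close>

lemma nonstandard_singleton:
  assumes "infinite L"
  obtains X where "X \<in> elts W (star bP)" "X \<notin> range star"
proof -
  obtain b where b: "b \<in> elts W (star bL)" "b \<notin> star ` elts V bL"
    using nonstandard_word [OF assms] .
  have "\<exists>X\<in>Pow L. elts V (bold_set V e X) = {e x}" if "x \<in> L" for x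
    using that bold_set(2) [of "{x}"] by (intro bexI [of _ "{x}"]) auto
  then have "sat V (env bP) (BAll 5 3 (BEx 6 2 (Doubleton 6 5 5)))"
    by (simp add: sat_BAll_elts bold_Pow bold_set(2) del: sat.simps(5))
  then have "sat W (star \<circ> env bP) (BAll 5 3 (BEx 6 2 (Doubleton 6 5 5)))"
    by (simp only: elementary_sat [OF E])
  then obtain X where X: "X \<in> elts W (star bP)" "elts W X = {b}"
    using b(1) by (auto simp: sat_BAll_elts simp del: sat.simps(5))
  have "X \<notin> range star"
  proof
    assume "X \<in> range star"
    then obtain a where a: "X = star a"
      by blast
    then obtain c where "b = star c"
      using elementary_singleton [OF E] X(2) by blast
    \<comment> \<open>Transferring membership down makes \<open>c\<close> the code of a word in
      \<open>L\<close>, contrary to the choice of \<open>b\<close>.\<close>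
    then show False
      using b elementary_mem [OF E] by blast
  qed
  with X(1) show thesis
    using that by blast
qed

text \<open>Members of \<open>sigma V star D\<close> are star-images of standard pairs and have
  standard first components, whereas \<open>C\<close> is also defined at a nonstandard argument
  \<open>X\<close>.\<close>

lemma not_sigma_star_op:
  assumes "infinite L" and C: "closure_relation W (star bP) (star bL) C" and D: "family_op V D"
  shows "elts W C \<noteq> sigma V star D"
proof
  assume eq: "elts W C = sigma V star D"
  obtain X where X: "X \<in> elts W (star bP)" "X \<notin> range star"
    using nonstandard_singleton [OF \<open>infinite L\<close>] .
  then obtain Y p where p: "p \<in> elts W C" "is_pair W p X Y"
    using C unfolding closure_relation_def related_def by blast
  then obtain q where q: "q \<in> elts V D" "p = star q"
    using eq unfolding sigma_def by blast
  then obtain x y where "is_pair V q x y"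
    using D unfolding family_op_def family_map_def by blast
  then have "is_pair W p (star x) (star y)"
    using elementary_is_pair [OF E] q(2) by simp
  then have "X = star x"
    using is_pair_inject [OF p(2)] by simp
  then show False
    using X(2) by simp
qed

lemma purely_subtle_strict_upper_bound:
  assumes T: "\<forall>C\<in>T. cons_op L C" and "infinite L"
    and C0: "C0 \<in> elts W (star (bold_ops V e L T))"
    and less: "\<And>C. C \<in> T \<Longrightarrow> star_less W (star bP) (star (bold_op V e L C)) C0"
  shows "purely_subtle V W star C0"
proof -
  \<comment> \<open>If \<open>C0\<close> were \<open>star D\<close>, membership would transfer down
    and make \<open>D\<close> the code of some \<open>C \<in> T\<close>; then \<open>C0\<close>
    would be strictly above itself.\<close>
  have "C0 \<noteq> star D" for D
  proof
    assume D: "C0 = star D"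
    then obtain C where "C \<in> T" "D = bold_op V e L C"
      using C0 elementary_mem [OF E] bold_ops(1) [OF T] by blast
    then show False
      using less D unfolding star_less_def by blast
  qed
  then show ?thesis
    unfolding purely_subtle_def
    using not_sigma_star_op [OF \<open>infinite L\<close> closure_relation_star_ops [OF T C0]]
      subtle_star_ops [OF T C0] by blast
qed

end

theorem theorem4p2:
  fixes \<A> :: "'c set" and L :: "'c list set" and code :: "'c list \<Rightarrow> nat"
    and h :: enat and atom :: "nat \<Rightarrow> 'v" and V :: "'v model"
    and W :: "'w model" and star :: "'v \<Rightarrow> 'w"
    and e :: "'c list \<Rightarrow> 'v"
    and T T' :: "('c list set \<Rightarrow> 'c list set) set"
  assumes "finite \<A>"
    and "L \<subseteq> lists \<A> - {[]}" and "infinite L"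
    and "inj_on code (lists \<A> - {[]})"
    and "superstructure h atom V" and "7 \<le> h"
    and "enlargement V W star"
    and "e = atom \<circ> code"
    and "T \<subseteq> cons_ops L" and "Complete_Partial_Order.chain (op_le L) T" and "T \<noteq> {}"
    and "T' \<subseteq> cons_ops L" and "Complete_Partial_Order.chain (op_le L) T'" and "T' \<noteq> {}"
    and "\<forall>C\<in>T'. \<exists>C'\<in>T'. op_less L C C'"
  shows "(\<exists>C0\<in>elts W (star (bold_ops V e L T)).
            \<forall>C\<in>T. star_le W (star (bold_Pow V e L)) (star (bold_op V e L C)) C0) \<and>
         (\<exists>C0'\<in>elts W (star (bold_ops V e L T')).
            purely_subtle V W star C0' \<and>
            (\<forall>C\<in>T'. star_less W (star (bold_Pow V e L)) (star (bold_op V e L C)) C0')) \<and>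
         (\<forall>C\<in>elts W (star (bold_ops V e L T)) \<union> elts W (star (bold_ops V e L T')).
            subtle V W star C)"
proof -
  \<comment> \<open>\<open>code\<close> is injective on nonempty words and \<open>atom\<close>
    everywhere.\<close>
  have "inj_on e L"
    using assms(2,4,5) unfolding \<open>e = atom \<circ> code\<close> superstructure_def
    by (meson comp_inj_on inj_on_subset subset_UNIV)
  moreover have "e ` L \<subseteq> elts V (nats V)"
    using \<open>superstructure h atom V\<close> unfolding \<open>e = atom \<circ> code\<close> superstructure_def by auto
  ultimately interpret nonstandard_transport h atom V e L W star
    using assms by unfold_locales
  have T: "\<forall>C\<in>T. cons_op L C" and T': "\<forall>C\<in>T'. cons_op L C"
    using \<open>T \<subseteq> cons_ops L\<close> \<open>T' \<subseteq> cons_ops L\<close> by (auto simp: cons_ops_def)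
  obtain C0 where C0: "C0 \<in> elts W (star (bold_ops V e L T))"
    "\<And>C. C \<in> T \<Longrightarrow> star_le W (star bP) (star (bold_op V e L C)) C0"
    using star_upper_bound [OF T \<open>T \<noteq> {}\<close>] assms by blast
  obtain C0' where C0': "C0' \<in> elts W (star (bold_ops V e L T'))"
    "\<And>C. C \<in> T' \<Longrightarrow> star_less W (star bP) (star (bold_op V e L C)) C0'"
    using star_strict_upper_bound [OF T' \<open>T' \<noteq> {}\<close>] assms by blast
  have "purely_subtle V W star C0'"
    using purely_subtle_strict_upper_bound [OF T' \<open>infinite L\<close> C0'] .
  then show ?thesis
    using C0 C0' subtle_star_ops [OF T] subtle_star_ops [OF T'] by blast
qed

end
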